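(* Let $n\ge 1$ be an integer. The group $\mathrm{Isom}\,\mathbb{R}^n$ (acting on $\mathbb{R}^n$) is fixating if and only if $n\le 3$.
   Context: $\mathbb{R}^n$ carries the usual Euclidean distance and $\mathrm{Isom}\,\mathbb{R}^n$ is the group of all its isometries (distance-preserving bijections). For a bijection $g$ of a set $X$, $\mathrm{Fix}\,g=\{x\in X: g(x)=x\}$. A group $H$ of bijections of $X$ is a GAF if $\mathrm{Fix}\,g\neq\emptyset$ for every $g\in H$; it is a GAG if $\bigcap_{g\in H}\mathrm{Fix}\,g\ne\emptyset$. A group $G$ of bijections of $X$ is fixating if every subgroup of $G$ that is a GAF is a GAG. *)

theory Defs
  imports "HOL-Analysis.Analysis" "HOL-Algebra.Bij"
begin

text \<open>
  A group of bijections of \<open>X\<close> is a subgroup of \<^term>\<open>BijGroup X\<close>. The predicates below are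
  meant for such subgroups; the group hypothesis on \<open>H\<close> is part of \<open>fixating\<close>, and
  \<open>subgroup_isom_group\<close> provides it for the isometry group.
\<close>

definition Fix :: "'a set \<Rightarrow> ('a \<Rightarrow> 'a) \<Rightarrow> 'a set" where
  "Fix X g = {x \<in> X. g x = x}"

definition GAF :: "'a set \<Rightarrow> ('a \<Rightarrow> 'a) set \<Rightarrow> bool" where
  "GAF X H \<longleftrightarrow> (\<forall>g\<in>H. Fix X g \<noteq> {})"

definition GAG :: "'a set \<Rightarrow> ('a \<Rightarrow> 'a) set \<Rightarrow> bool" where
  "GAG X H \<longleftrightarrow> (\<Inter>g\<in>H. Fix X g) \<noteq> {}"

definition fixating :: "'a set \<Rightarrow> ('a \<Rightarrow> 'a) set \<Rightarrow> bool" where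
  "fixating X G \<longleftrightarrow> (\<forall>H. subgroup H (BijGroup X) \<and> H \<subseteq> G \<and> GAF X H \<longrightarrow> GAG X H)"

definition isom_group :: "('a::metric_space \<Rightarrow> 'a) set" where
  "isom_group = {f \<in> Bij UNIV. \<forall>x y. dist (f x) (f y) = dist x y}"

lemma subgroup_isom_group:
  "subgroup (isom_group :: ('a::metric_space \<Rightarrow> 'a) set) (BijGroup UNIV)"
proof (rule group.subgroupI[OF group_BijGroup])
  show "(isom_group :: ('a \<Rightarrow> 'a) set) \<subseteq> carrier (BijGroup UNIV)"
    by (auto simp: isom_group_def BijGroup_def)
  have "id \<in> (isom_group :: ('a \<Rightarrow> 'a) set)"
    by (simp add: isom_group_def Bij_def)
  then show "(isom_group :: ('a \<Rightarrow> 'a) set) \<noteq> {}" by blast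
next
  fix f :: "'a \<Rightarrow> 'a" assume f: "f \<in> isom_group"
  then have B: "f \<in> Bij UNIV" and d: "\<And>x y. dist (f x) (f y) = dist x y"
    by (auto simp: isom_group_def)
  then have "surj f" by (auto simp: Bij_def bij_betw_def)
  then have "dist (inv_into UNIV f x) (inv_into UNIV f y) = dist x y" for x y
    using d[of "inv_into UNIV f x" "inv_into UNIV f y"] by (simp add: surj_f_inv_f)
  then show "inv\<^bsub>BijGroup UNIV\<^esub> f \<in> isom_group"
    using B restrict_inv_into_Bij[OF B] by (simp add: inv_BijGroup isom_group_def)
next
  fix f g :: "'a \<Rightarrow> 'a" assume "f \<in> isom_group" "g \<in> isom_group"
  then show "f \<otimes>\<^bsub>BijGroup UNIV\<^esub> g \<in> isom_group"
    using compose_Bij[of f UNIV g]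
    by (auto simp: isom_group_def BijGroup_def compose_def)
qed

end

theory Submission
  imports Defs
begin

text \<open>
  A GAF in a Euclidean space stays one, with the same verdict on common fixed points, when its
  elements are extended to a larger Euclidean space by the identity on the orthogonal complement
  (\<open>fixating_isom_group_mono\<close>). So it suffices to see that dimension three is fixating and dimension
  four is not.

  In dimension four, identify the space with the quaternions. Left multiplication by \<open>q \<noteq> 1\<close> has no
  nonzero fixed vector, so every affine map \<open>x \<mapsto> q x + c\<close> with \<open>q \<noteq> 1\<close> has a fixed point. Now take two
  unit quaternions that generate a free group, here \<open>(3 + 4i) / 5\<close> and \<open>(3 + 4j) / 5\<close>, and turn by
  them about two different points. A nonempty reduced word has linear part \<open>\<noteq> 1\<close> by freeness
  (\<open>word_quat_reduced\<close>), so every element of the group generated has a fixed point, but there is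
  no common one (\<open>not_fixating_isom_group_4\<close>). Freeness is what allows the two centres to be chosen
  independently: a relation between the unit quaternions could turn into a translation.

  In dimension three, the elements of a GAF that preserve the orientation are rotations about lines.
  No element is a nontrivial translation or screw motion, and this makes any two axes meet
  (\<open>axes_meet\<close>). Lines that meet pairwise either have a common point or lie in one plane; the
  conjugates of the given rotations rule out three axes that form a triangle
  (\<open>fixes_isolated_intersection\<close>). So the orientation-preserving elements have a common fixed point,
  and averaging it over the remaining coset gives one for the whole group
  (\<open>fixating_isom_group_3\<close>).
\<close>

section \<open>Subgroups of isometries and their extension to larger spaces\<close>

text \<open>
  On the whole type every function is extensional, so the restrictions built into \<open>BijGroup\<close>
  disappear and its operations are plain composition and inversion.
\<close>

lemma subgroup_BijGroup_UNIV_iff: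
  "subgroup H (BijGroup (UNIV :: 'a set)) \<longleftrightarrow>
    (\<forall>f\<in>H. bij f) \<and> id \<in> H \<and> (\<forall>f\<in>H. \<forall>g\<in>H. f \<circ> g \<in> H) \<and> (\<forall>f\<in>H. inv_into UNIV f \<in> H)"
    (is "?L \<longleftrightarrow> ?R")
proof -
  interpret group "BijGroup (UNIV :: 'a set)" by (rule group_BijGroup)
  have carrier: "f \<in> carrier (BijGroup UNIV) \<longleftrightarrow> bij f" for f :: "'a \<Rightarrow> 'a"
    by (simp add: BijGroup_def Bij_def)
  have mult: "f \<otimes>\<^bsub>BijGroup UNIV\<^esub> g = f \<circ> g" if "bij f" "bij g" for f g :: "'a \<Rightarrow> 'a"
    using that by (simp add: BijGroup_def Bij_def compose_def fun_eq_iff)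
  have one: "\<one>\<^bsub>BijGroup UNIV\<^esub> = (id :: 'a \<Rightarrow> 'a)"
    by (simp add: BijGroup_def fun_eq_iff)
  have minv: "inv\<^bsub>BijGroup UNIV\<^esub> f = inv_into UNIV f" if "bij f" for f :: "'a \<Rightarrow> 'a"
    using that by (simp add: inv_BijGroup Bij_def restrict_def)
  show ?thesis
  proof
    assume H: ?L
    then have b: "bij f" if "f \<in> H" for f
      using that carrier subgroup.subset by blast
    then show ?R
      using H subgroup.m_closed[OF H] subgroup.one_closed[OF H] subgroup.m_inv_closed[OF H] 
      by (metis one mult minv)
  next
    assume R: ?R
    show ?L
      by (rule subgroupI) (use R carrier mult minv in \<open>auto\<close>)
  qed
qed

text \<open>
  An isometry of a subspace extends to the whole space by acting trivially on the orthogonal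
  complement. This turns a GAF that is not a GAG in the small space into one in the large space:
  fixed points are carried over by the embedding, and back by its adjoint, the orthogonal projection.
\<close>

lemma fixating_isom_group_mono:
  assumes dim: "DIM('a::euclidean_space) \<le> DIM('b::euclidean_space)"
    and fixating: "fixating UNIV (isom_group :: ('b \<Rightarrow> 'b) set)"
  shows "fixating UNIV (isom_group :: ('a \<Rightarrow> 'a) set)"
proof -
  obtain E :: "'a \<Rightarrow> 'b" where "linear E" and norm_E: "\<And>x. norm (E x) = norm x"
    using isometry_subset_subspace[of "UNIV :: 'a set" "UNIV :: 'b set"] dim by auto
  define R where "R = adjoint E"
  interpret E: linear E by fact
  have adj: "E x \<bullet> y = x \<bullet> R y" for x y
    using adjoint_works[OF \<open>linear E\<close>] by (simp add: R_def)
  have inner_E: "E x \<bullet> E y = x \<bullet> y" for x y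
    using norm_E by (simp add: dot_norm flip: E.add)
  have RE: "R (E x) = x" for x
    by (metis adj inner_E inner_commute vector_eq_ldot)
  interpret R: linear R
    unfolding R_def using \<open>linear E\<close> by (rule adjoint_linear)
  define ext where ext: "ext g y = E (g (R y)) + (y - E (R y))" for g y
  have R_ext: "R (ext g y) = g (R y)" for g y
    by (simp add: ext RE R.add R.diff)
  have ext_comp: "ext (g \<circ> h) = ext g \<circ> ext h" for g h
    by (auto simp: fun_eq_iff R_ext ext[of g "ext h _"]) (simp add: ext)
  have ext_id: "ext id = id"
    by (auto simp: fun_eq_iff ext)
  have dist_ext: "dist (ext g x) (ext g y) = dist x y" if "\<And>x y. dist (g x) (g y) = dist x y" for g x y
  proof -
    define d where "d = x - y"
    define a where "a = g (R x) - g (R y)"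
    have "ext g x - ext g y = E a + (d - E (R d))"
      by (simp add: ext a_def d_def E.diff R.diff)
    moreover have orth: "E b \<bullet> (d - E (R d)) = 0" for b
      by (simp add: inner_diff_right adj RE)
    then have "(norm (E b + (d - E (R d))))\<^sup>2 = (norm b)\<^sup>2 + (norm (d - E (R d)))\<^sup>2" for b
      by (subst norm_add_Pythagorean) (simp_all add: orthogonal_def norm_E)
    moreover have "norm a = norm (R d)"
      using that[of "R x" "R y"] by (simp add: a_def d_def dist_norm R.diff)
    ultimately have "(norm (ext g x - ext g y))\<^sup>2 = (norm (E (R d) + (d - E (R d))))\<^sup>2"
      by metis
    then show ?thesis by (simp add: d_def dist_norm)
  qed
  have "GAG UNIV H" if H: "subgroup H (BijGroup UNIV)" "H \<subseteq> isom_group" "GAF UNIV H" for H :: "('a \<Rightarrow> 'a) set"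
  proof -
    note H' = H(1)[unfolded subgroup_BijGroup_UNIV_iff]
    have inverses: "ext g \<circ> ext (inv_into UNIV g) = id" "ext (inv_into UNIV g) \<circ> ext g = id" if "g \<in> H" for g
    proof -
      have "bij g" using that H' by blast
      then have "g \<circ> inv_into UNIV g = id" "inv_into UNIV g \<circ> g = id"
        by (simp_all add: bij_is_surj bij_is_inj flip: surj_iff)
      then show "ext g \<circ> ext (inv_into UNIV g) = id" "ext (inv_into UNIV g) \<circ> ext g = id"
        by (simp_all add: ext_id flip: ext_comp)
    qed
    then have bij_ext: "bij (ext g)" if "g \<in> H" for g
      using o_bij that by blast
    have "inv_into UNIV (ext g) = ext (inv_into UNIV g)" if "g \<in> H" for g
      using inverses[OF that] by (rule inv_unique_comp)
    then have "subgroup (ext ` H) (BijGroup UNIV)"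
      unfolding subgroup_BijGroup_UNIV_iff using H' bij_ext
      by (auto simp flip: ext_comp) (metis ext_id imageI)
    moreover have "ext ` H \<subseteq> isom_group"
      using bij_ext H(2) dist_ext by (auto simp: isom_group_def Bij_def)
    moreover have "GAF UNIV (ext ` H)"
      unfolding GAF_def Fix_def
    proof clarsimp
      fix g assume "g \<in> H"
      then obtain x where "g x = x" using H(3) by (auto simp: GAF_def Fix_def)
      then have "ext g (E x) = E x" by (simp add: ext RE)
      then show "\<exists>y. ext g y = y" by blast
    qed
    ultimately have "GAG UNIV (ext ` H)"
      using fixating by (auto simp: fixating_def)
    then obtain y where y: "\<And>g. g \<in> H \<Longrightarrow> ext g y = y"
      unfolding GAG_def Fix_def by blast
    then have "g (R y) = R y" if "g \<in> H" for g
      using R_ext[of g y] that by simp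
    then show ?thesis by (auto simp: GAG_def Fix_def)
  qed
  then show ?thesis by (simp add: fixating_def)
qed

section \<open>Quaternions\<close>

text \<open>
  Quaternion multiplication on \<open>complex \<times> complex\<close>: the pair \<open>p\<close> stands for the
  matrix with first column \<open>p\<close> in the usual model of the quaternions by complex matrices
  \<open>(a, - cnj b; b, cnj a)\<close>, and \<open>p \<diamondop> q\<close> is that matrix applied to \<open>q\<close>. Pairs of complex numbers are
  a Euclidean space of dimension four already, so distance and dimension come with the type.
\<close>

definition qmul :: "complex \<times> complex \<Rightarrow> complex \<times> complex \<Rightarrow> complex \<times> complex" (infixl "\<diamondop>" 70) where
  "p \<diamondop> q = (fst p * fst q - cnj (snd p) * snd q, snd p * fst q + cnj (fst p) * snd q)"

definition qcnj :: "complex \<times> complex \<Rightarrow> complex \<times> complex" where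
  "qcnj p = (cnj (fst p), - snd p)"

abbreviation qone :: "complex \<times> complex" where "qone \<equiv> (1, 0)"

lemma qmul_assoc: "(p \<diamondop> q) \<diamondop> r = p \<diamondop> (q \<diamondop> r)"
  by (simp add: qmul_def algebra_simps)

lemma qmul_distribs:
  "(p + q) \<diamondop> r = p \<diamondop> r + q \<diamondop> r" "r \<diamondop> (p + q) = r \<diamondop> p + r \<diamondop> q"
  "(p - q) \<diamondop> r = p \<diamondop> r - q \<diamondop> r" "r \<diamondop> (p - q) = r \<diamondop> p - r \<diamondop> q"
  by (simp_all add: qmul_def algebra_simps)

lemma qmul_scaleR: "(c *\<^sub>R p) \<diamondop> q = c *\<^sub>R (p \<diamondop> q)" "p \<diamondop> (c *\<^sub>R q) = c *\<^sub>R (p \<diamondop> q)"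
  by (simp_all add: qmul_def algebra_simps)

lemma qmul_one [simp]: "qone \<diamondop> p = p" "p \<diamondop> qone = p"
  by (simp_all add: qmul_def)

lemma norm_qpower2: "(norm p)\<^sup>2 = (cmod (fst p))\<^sup>2 + (cmod (snd p))\<^sup>2" for p :: "complex \<times> complex"
  by (simp add: norm_prod_def)

lemma qcnj_qmul: "qcnj p \<diamondop> (p \<diamondop> q) = (norm p)\<^sup>2 *\<^sub>R q"  "p \<diamondop> (qcnj p \<diamondop> q) = (norm p)\<^sup>2 *\<^sub>R q"
  unfolding qmul_def qcnj_def norm_qpower2 cmod_power2
  by (simp_all add: prod_eq_iff complex_eq_iff power2_eq_square algebra_simps)

lemma norm_qmul: "norm (p \<diamondop> q) = norm p * norm q"
proof -
  have "(norm (p \<diamondop> q))\<^sup>2 = (norm p * norm q)\<^sup>2"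
    unfolding power_mult_distrib norm_qpower2 qmul_def fst_conv snd_conv cmod_power2
    by (simp add: power2_eq_square algebra_simps)
  then show ?thesis by simp
qed

text \<open>
  The ring of Lipschitz quaternions.
\<close>

definition lipschitz :: "(complex \<times> complex) set" where
  "lipschitz = {p. Re (fst p) \<in> \<int> \<and> Im (fst p) \<in> \<int> \<and> Re (snd p) \<in> \<int> \<and> Im (snd p) \<in> \<int>}"

definition five_lipschitz :: "(complex \<times> complex) set" where
  "five_lipschitz = {p. (1/5) *\<^sub>R p \<in> lipschitz}"

lemma lipschitz_add: "p \<in> lipschitz \<Longrightarrow> q \<in> lipschitz \<Longrightarrow> p + q \<in> lipschitz"
  and lipschitz_diff: "p \<in> lipschitz \<Longrightarrow> q \<in> lipschitz \<Longrightarrow> p - q \<in> lipschitz"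
  and lipschitz_qmul: "p \<in> lipschitz \<Longrightarrow> q \<in> lipschitz \<Longrightarrow> p \<diamondop> q \<in> lipschitz"
  and lipschitz_scaleR: "c \<in> \<int> \<Longrightarrow> q \<in> lipschitz \<Longrightarrow> c *\<^sub>R q \<in> lipschitz"
  by (auto simp: lipschitz_def qmul_def)

lemma five_lipschitz_add: "p \<in> five_lipschitz \<Longrightarrow> q \<in> five_lipschitz \<Longrightarrow> p + q \<in> five_lipschitz"
  and five_lipschitz_diff: "p \<in> five_lipschitz \<Longrightarrow> q \<in> five_lipschitz \<Longrightarrow> p - q \<in> five_lipschitz"
  and five_lipschitz_qmul: "p \<in> lipschitz \<Longrightarrow> q \<in> five_lipschitz \<Longrightarrow> p \<diamondop> q \<in> five_lipschitz"
  and five_lipschitz_scaleR: "c \<in> \<int> \<Longrightarrow> q \<in> five_lipschitz \<Longrightarrow> c *\<^sub>R q \<in> five_lipschitz"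
  and five_lipschitz_five: "q \<in> lipschitz \<Longrightarrow> 5 *\<^sub>R q \<in> five_lipschitz"
  unfolding five_lipschitz_def
  using lipschitz_add[of "(1/5) *\<^sub>R p" "(1/5) *\<^sub>R q"] lipschitz_diff[of "(1/5) *\<^sub>R p" "(1/5) *\<^sub>R q"]
    lipschitz_qmul[of p "(1/5) *\<^sub>R q"] lipschitz_scaleR[of c "(1/5) *\<^sub>R q"]
  by (simp_all add: scaleR_add_right scaleR_diff_right qmul_scaleR mult.commute)

text \<open>
  A letter is a generator (first component) together with a sign for its exponent (second component).
\<close>

type_synonym letter = "bool \<times> bool"

definition inv_letter :: "letter \<Rightarrow> letter" where "inv_letter l = (fst l, \<not> snd l)"

lemma inv_letter_invol [simp]: "inv_letter (inv_letter l) = l"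
  by (simp add: inv_letter_def)

text \<open>
  Four integral quaternions of norm \<open>5\<close>, namely \<open>3 \<plusminus> 4i\<close> and \<open>3 \<plusminus> 4j\<close>. Divided by \<open>5\<close> they become
  two unit quaternions with rational coordinates and their inverses. The denominator \<open>5\<close> is what
  makes the two units free: it survives in every nonempty reduced product.
\<close>

definition quat :: "letter \<Rightarrow> complex \<times> complex" where
  "quat l = (let s = (if snd l then 4 else -4) in if fst l then (Complex 3 s, 0) else (3, of_real s))"

lemma quat_lattice: "quat l \<in> lipschitz"
  by (auto simp: quat_def lipschitz_def)

lemma norm_quat: "norm (quat l) = 5"
proof -
  have "(norm (quat l))\<^sup>2 = 5\<^sup>2"
    by (simp add: quat_def norm_qpower2 cmod_power2 Let_def)
  then show ?thesis by (rule power2_eq_imp_eq) simp_all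
qed

lemma quat_inv_letter: "quat (inv_letter l) = qcnj (quat l)"
  by (auto simp: quat_def inv_letter_def qcnj_def Let_def complex_eq_iff)

text \<open>
  What matters about these values is that none of them is divisible by \<open>5\<close>, so that the sum is
  invertible modulo \<open>5\<close>.
\<close>

lemma norm_quat_add:
  assumes "l \<noteq> inv_letter m"
  shows "(norm (quat l + quat (inv_letter m)))\<^sup>2 \<in> {36, 68}"
  using assms
  by (cases l; cases m) (auto simp: quat_def norm_qpower2 cmod_power2 inv_letter_def Let_def split: if_splits)

section \<open>A free group of isometries of four-dimensional space\<close>

text \<open>
  One generator turns about \<open>0\<close> and the other about \<open>1\<close>. Left multiplication by a quaternion other
  than \<open>1\<close> fixes only \<open>0\<close>, so each generator fixes only its centre, and different centres exclude a
  common fixed point.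
\<close>

definition centre :: "letter \<Rightarrow> complex \<times> complex" where
  "centre l = (if fst l then 0 else qone)"

definition motion :: "letter \<Rightarrow> complex \<times> complex \<Rightarrow> complex \<times> complex" where
  "motion l x = centre l + (1/5) *\<^sub>R (quat l \<diamondop> (x - centre l))"

fun act :: "letter list \<Rightarrow> complex \<times> complex \<Rightarrow> complex \<times> complex" where
  "act [] = id"
| "act (l # w) = motion l \<circ> act w"

fun word_quat :: "letter list \<Rightarrow> complex \<times> complex" where
  "word_quat [] = qone"
| "word_quat (l # w) = quat l \<diamondop> word_quat w"

fun reduced :: "letter list \<Rightarrow> bool" where
  "reduced (l # m # w) \<longleftrightarrow> l \<noteq> inv_letter m \<and> reduced (m # w)"
| "reduced _ \<longleftrightarrow> True"

lemma act_append: "act (v @ w) = act v \<circ> act w"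
  by (induction v) (simp_all add: comp_assoc)

lemma motion_inv_letter: "motion (inv_letter l) (motion l x) = x"
proof -
  have "centre (inv_letter l) = centre l"
    by (simp add: centre_def inv_letter_def)
  then show ?thesis
    by (simp add: motion_def qmul_scaleR quat_inv_letter qcnj_qmul norm_quat)
qed

lemma dist_motion: "dist (motion l x) (motion l y) = dist x y"
proof -
  have "motion l x - motion l y = (1/5) *\<^sub>R (quat l \<diamondop> (x - y))"
    by (simp add: motion_def qmul_distribs algebra_simps)
  then show ?thesis by (simp add: dist_norm norm_qmul norm_quat)
qed

lemma motion_fixes_only_centre:
  assumes "motion l x = x" shows "x = centre l"
proof -
  define y where "y = x - centre l"
  have "y = (1/5) *\<^sub>R (quat l \<diamondop> y)"
    using assms unfolding motion_def y_def by (metis add_diff_cancel_left')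
  then have "5 *\<^sub>R y = 5 *\<^sub>R ((1/5) *\<^sub>R (quat l \<diamondop> y))"
    by simp
  then have "(quat l - 5 *\<^sub>R qone) \<diamondop> y = 0"
    unfolding qmul_distribs qmul_scaleR by simp
  then have "norm (quat l - 5 *\<^sub>R qone) * norm y = 0"
    by (simp flip: norm_qmul)
  moreover have "quat l \<noteq> 5 *\<^sub>R qone"
    by (auto simp: quat_def Let_def complex_eq_iff)
  ultimately show ?thesis by (simp add: y_def)
qed

text \<open>
  The linear part of a word is left multiplication by one quaternion, so a fixed point is a solution of
  \<open>(1 - q) x = c\<close>, which exists as soon as \<open>q \<noteq> 1\<close>.
\<close>

lemma act_affine: "act w x = (1 / 5 ^ length w) *\<^sub>R (word_quat w \<diamondop> x) + act w 0"
proof (induction w)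
  case (Cons l w)
  have "act (l # w) x - act (l # w) 0 = (1/5) *\<^sub>R (quat l \<diamondop> (act w x - act w 0))"
    by (simp add: motion_def qmul_distribs algebra_simps)
  also have "act w x - act w 0 = (1 / 5 ^ length w) *\<^sub>R (word_quat w \<diamondop> x)"
    using Cons.IH by (metis add_diff_cancel_right')
  finally show ?case
    by (simp add: qmul_scaleR qmul_assoc algebra_simps del: act.simps)
qed simp

lemma exists_reduced_word: "\<exists>v. reduced v \<and> act v = act w"
proof (induction w)
  case Nil
  then show ?case by (metis reduced.simps(2))
next
  case (Cons l w)
  then obtain v where v: "reduced v" "act v = act w" by blast
  show ?case
  proof (cases "\<exists>m u. v = m # u \<and> l = inv_letter m")
    case True
    then obtain m u where u: "v = m # u" "l = inv_letter m" by blast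
    have "reduced u" using v(1) u(1) by (cases u) auto
    moreover have "act u = act (l # w)"
      using v(2) u by (auto simp: fun_eq_iff motion_inv_letter simp flip: v(2))
    ultimately show ?thesis by blast
  next
    case False
    then have "reduced (l # v)" using v(1) by (cases v) auto
    with v(2) show ?thesis by (metis act.simps(2))
  qed
qed

lemma word_quat_lattice: "word_quat w \<in> lipschitz"
proof (induction w)
  case Nil
  then show ?case by (simp add: lipschitz_def)
next
  case (Cons l w)
  then show ?case using lipschitz_qmul quat_lattice by simp
qed

text \<open>
  Ping-pong modulo \<open>5\<close>. The second conjunct records the first letter of the word: multiplying by its
  conjugate kills the product modulo \<open>5\<close>. If the product died already after putting the next letter
  \<open>l\<close> in front of a word \<open>W\<close> starting with \<open>m\<close>, then both \<open>quat l\<close> and the conjugate of \<open>quat m\<close>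
  would kill \<open>W\<close>, hence so would their sum. But for \<open>l\<close> not inverse to \<open>m\<close> this sum is invertible
  modulo \<open>5\<close>.
\<close>

lemma word_quat_reduced:
  assumes "reduced (l # w)"
  shows "word_quat (l # w) \<notin> five_lipschitz \<and> quat (inv_letter l) \<diamondop> word_quat (l # w) \<in> five_lipschitz"
  using assms
proof (induction w arbitrary: l)
  case Nil
  have "quat (inv_letter l) \<diamondop> quat l = 25 *\<^sub>R qone"
    using qcnj_qmul(1)[of "quat l" qone] by (simp add: quat_inv_letter norm_quat)
  then show ?case
    by (auto simp: five_lipschitz_def lipschitz_def quat_def Let_def elim!: Ints_cases)
next
  case (Cons m w)
  define W where "W = word_quat (m # w)"
  have W: "W \<in> lipschitz" "W \<notin> five_lipschitz" "quat (inv_letter m) \<diamondop> W \<in> five_lipschitz"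
    unfolding W_def using Cons.IH[of m] Cons.prems word_quat_lattice[of "m # w"] by auto
  have "l \<noteq> inv_letter m" using Cons.prems by simp
  define s where "s = quat l + quat (inv_letter m)"
  have s: "s \<in> lipschitz"
    unfolding s_def by (intro lipschitz_add quat_lattice)
  have "quat l \<diamondop> W \<notin> five_lipschitz"
  proof
    assume "quat l \<diamondop> W \<in> five_lipschitz"
    then have "s \<diamondop> W \<in> five_lipschitz"
      unfolding s_def qmul_distribs using W(3) by (rule five_lipschitz_add)
    moreover have "qcnj s \<in> lipschitz"
      using s by (auto simp: lipschitz_def qcnj_def)
    ultimately have mult: "(norm s)\<^sup>2 *\<^sub>R W \<in> five_lipschitz"
      by (metis five_lipschitz_qmul qcnj_qmul(1))
    \<comment> \<open>Both \<open>36 - 35\<close> and \<open>2 * 68 - 135\<close> equal \<open>1\<close>: inverting \<open>36\<close> and \<open>68\<close> modulo \<open>5\<close>.\<close>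
    have five: "(5 * k) *\<^sub>R W \<in> five_lipschitz" if "k \<in> \<int>" for k
      using five_lipschitz_five[OF lipschitz_scaleR[OF that W(1)]] by simp
    from norm_quat_add[OF \<open>l \<noteq> inv_letter m\<close>] consider "(norm s)\<^sup>2 = 36" | "(norm s)\<^sup>2 = 68"
      by (auto simp: s_def)
    then show False
    proof cases
      case 1
      with mult five[of 7] have "36 *\<^sub>R W - 35 *\<^sub>R W \<in> five_lipschitz"
        by (intro five_lipschitz_diff) auto
      then show False using W(2) by (simp flip: scaleR_left_diff_distrib)
    next
      case 2
      with mult five[of 27] have "2 *\<^sub>R (68 *\<^sub>R W) - 135 *\<^sub>R W \<in> five_lipschitz"
        by (intro five_lipschitz_diff[OF five_lipschitz_scaleR[of 2 "68 *\<^sub>R W"]]) auto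
      then show False using W(2) by (simp flip: scaleR_left_diff_distrib)
    qed
  qed
  moreover have "quat (inv_letter l) \<diamondop> (quat l \<diamondop> W) \<in> five_lipschitz"
    using five_lipschitz_five[of "5 *\<^sub>R W"] lipschitz_scaleR[of 5 W] W(1)
    by (simp add: quat_inv_letter qcnj_qmul norm_quat)
  ultimately show ?case by (simp add: W_def)
qed

text \<open>
  If the linear part of a nonempty reduced word of length \<open>n\<close> were the identity, its integral quaternion
  would be \<open>5 ^ n\<close>, which is divisible by \<open>5\<close>.
\<close>

lemma act_reduced_fixed_point:
  assumes "reduced w" shows "\<exists>x. act w x = x"
proof (cases w)
  case (Cons l v)
  define q where "q = qone - (1 / 5 ^ length w) *\<^sub>R word_quat w"
  have "q \<noteq> 0"
  proof
    assume "q = 0"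
    then have "qone = (1 / 5 ^ length w) *\<^sub>R word_quat w" by (simp add: q_def)
    then have "5 ^ length w *\<^sub>R qone = 5 ^ length w *\<^sub>R ((1 / 5 ^ length w) *\<^sub>R word_quat w)"
      by (rule arg_cong)
    then have "5 ^ length w *\<^sub>R qone = word_quat w" by simp
    moreover have "5 ^ length w *\<^sub>R qone = 5 *\<^sub>R (5 ^ length v *\<^sub>R qone)"
      by (simp add: Cons)
    moreover have "5 ^ length v *\<^sub>R qone \<in> lipschitz"
      by (auto simp: lipschitz_def)
    ultimately have "word_quat w \<in> five_lipschitz"
      using five_lipschitz_five by metis
    then show False using word_quat_reduced assms Cons by blast
  qed
  define c where "c = act w 0"
  define x where "x = (1 / (norm q)\<^sup>2) *\<^sub>R (qcnj q \<diamondop> c)"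
  have "q \<diamondop> x = c"
    using \<open>q \<noteq> 0\<close> by (simp add: x_def qmul_scaleR qcnj_qmul)
  then have "x = (1 / 5 ^ length w) *\<^sub>R (word_quat w \<diamondop> x) + c"
    by (simp add: q_def qmul_distribs qmul_scaleR algebra_simps)
  then show ?thesis using act_affine[of w x] unfolding c_def by metis
qed auto

lemma act_inverse: "act (map inv_letter (rev w)) \<circ> act w = id"
proof (induction w)
  case (Cons l w)
  then show ?case
    by (auto simp: act_append fun_eq_iff motion_inv_letter)
qed simp

lemma act_inverse': "act w \<circ> act (map inv_letter (rev w)) = id"
  using act_inverse[of "map inv_letter (rev w)"] by (simp add: rev_map comp_def)

text \<open>
  The free group generated by the two rotations acts with a fixed point for every element, but no
  point is fixed by both generators.
\<close>

lemma not_fixating_isom_group_4: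
  "\<not> fixating UNIV (isom_group :: (complex \<times> complex \<Rightarrow> complex \<times> complex) set)"
proof
  assume fixating: "fixating UNIV (isom_group :: (complex \<times> complex \<Rightarrow> complex \<times> complex) set)"
  have bij: "bij (act w)" for w
    using act_inverse act_inverse' by (rule o_bij)
  have "inv_into UNIV (act w) = act (map inv_letter (rev w))" for w
    using act_inverse act_inverse' by (rule inv_unique_comp[rotated])
  then have "subgroup (range act) (BijGroup UNIV)"
    unfolding subgroup_BijGroup_UNIV_iff using bij
    by (auto simp flip: act_append) (metis act.simps(1) rangeI)
  moreover have "dist (act w x) (act w y) = dist x y" for w x y
    by (induction w) (simp_all add: dist_motion)
  then have "range act \<subseteq> isom_group"
    using bij by (auto simp: isom_group_def Bij_def)
  moreover have "GAF UNIV (range act)"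
    unfolding GAF_def Fix_def using act_reduced_fixed_point exists_reduced_word
    by clarsimp (metis surj_pair)
  ultimately have "GAG UNIV (range act)"
    using fixating by (auto simp: fixating_def)
  then obtain x where "act [l] x = x" for l
    unfolding GAG_def Fix_def by blast
  then have "centre l = x" for l
    using motion_fixes_only_centre[of l x] by simp
  from this[of "(True, True)"] this[of "(False, True)"] show False
    by (auto simp: centre_def prod_eq_iff)
qed

section \<open>Rotations of three-dimensional space\<close>

unbundle cross3_syntax

definition linear_part :: "('a::real_normed_vector \<Rightarrow> 'a) \<Rightarrow> 'a \<Rightarrow> 'a" where
  "linear_part f x = f x - f 0"

text \<open>
  Preserving the cross product singles out the orientation-preserving isometries. It takes the place of
  the determinant because cross products are what the arguments on axes compute with.
\<close>

definition rigid_motion :: "(real^3 \<Rightarrow> real^3) \<Rightarrow> bool" where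
  "rigid_motion f \<longleftrightarrow> orthogonal_transformation (linear_part f) \<and>
    (\<forall>x y. linear_part f (x \<times> y) = linear_part f x \<times> linear_part f y)"

lemma orthogonal_linear_part:
  fixes f :: "'a::euclidean_space \<Rightarrow> 'a"
  assumes "\<And>x y. dist (f x) (f y) = dist x y"
  shows "orthogonal_transformation (linear_part f)"
  unfolding orthogonal_transformation_isometry linear_part_def using assms by (simp add: dist_norm)

lemma linear_part_diff:
  assumes "orthogonal_transformation (linear_part f)"
  shows "linear_part f (x - y) = f x - f y"
proof -
  interpret linear "linear_part f" using assms by (rule orthogonal_transformation_linear)
  show ?thesis unfolding diff by (simp add: linear_part_def)
qed

lemma linear_part_comp:
  assumes "orthogonal_transformation (linear_part f)"
  shows "linear_part (f \<circ> g) x = linear_part f (linear_part g x)"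
  using linear_part_diff[OF assms, of "g x" "g 0"] by (simp add: linear_part_def)

lemma fixed_iff_linear_part:
  assumes "orthogonal_transformation (linear_part f)" "f p = p"
  shows "f x = x \<longleftrightarrow> linear_part f (x - p) = x - p"
  by (simp add: linear_part_diff[OF assms(1)] assms(2))

text \<open>
  Expansion of \<open>w\<close> along \<open>n = u \<times> v\<close> and the plane orthogonal to \<open>n\<close>, written using cross products
  only. A linear map that respects cross products and fixes two independent vectors \<open>u\<close> and \<open>v\<close>
  therefore fixes every vector.
\<close>

lemma cross_decomposition:
  fixes u v w :: "real^3"
  shows "((u \<times> v) \<bullet> (u \<times> v)) *\<^sub>R w =
    (w \<bullet> (u \<times> v)) *\<^sub>R (u \<times> v) + (w \<bullet> v) *\<^sub>R ((u \<times> v) \<times> u) - (w \<bullet> u) *\<^sub>R ((u \<times> v) \<times> v)"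
proof -
  define n where "n = u \<times> v"
  have "(n \<bullet> n) *\<^sub>R w = (w \<bullet> n) *\<^sub>R n + n \<times> (w \<times> n)"
    by (simp add: Lagrange inner_commute)
  also have "w \<times> n = (w \<bullet> v) *\<^sub>R u - (w \<bullet> u) *\<^sub>R v"
    by (simp add: n_def Lagrange)
  finally show ?thesis
    by (simp add: n_def cross_mult_right Cross3.right_diff_distrib)
qed

lemma in_plane_of_cross:
  fixes u v w :: "real^3"
  assumes "u \<times> v \<noteq> 0" "w \<bullet> (u \<times> v) = 0"
  obtains s t where "w = s *\<^sub>R u + t *\<^sub>R v"
proof -
  define n where "n = u \<times> v"
  have n: "n \<bullet> n \<noteq> 0" using assms(1) by (simp add: n_def)
  have n_cross: "n \<times> u = (u \<bullet> u) *\<^sub>R v - (v \<bullet> u) *\<^sub>R u" "n \<times> v = (u \<bullet> v) *\<^sub>R v - (v \<bullet> v) *\<^sub>R u"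
    unfolding n_def cross_skew[of "u \<times> v"] by (simp_all add: Lagrange inner_commute)
  have "(n \<bullet> n) *\<^sub>R w = (w \<bullet> v) *\<^sub>R (n \<times> u) - (w \<bullet> u) *\<^sub>R (n \<times> v)"
    using cross_decomposition[of u v w] assms(2) by (simp add: n_def)
  then have "(n \<bullet> n) *\<^sub>R w = ((w \<bullet> v) * - (v \<bullet> u) + (w \<bullet> u) * (v \<bullet> v)) *\<^sub>R u +
      ((w \<bullet> v) * (u \<bullet> u) - (w \<bullet> u) * (u \<bullet> v)) *\<^sub>R v"
    unfolding n_cross by (simp add: algebra_simps)
  then have "(1 / (n \<bullet> n)) *\<^sub>R (n \<bullet> n) *\<^sub>R w =
      (1 / (n \<bullet> n)) *\<^sub>R (((w \<bullet> v) * - (v \<bullet> u) + (w \<bullet> u) * (v \<bullet> v)) *\<^sub>R u +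
      ((w \<bullet> v) * (u \<bullet> u) - (w \<bullet> u) * (u \<bullet> v)) *\<^sub>R v)" by simp
  then show ?thesis using n that by (simp add: scaleR_add_right)
qed

lemma parallel_of_cross_eq_0:
  fixes u v :: "real^3"
  assumes "u \<times> v = 0" "v \<noteq> 0"
  obtains c where "u = c *\<^sub>R v"
proof -
  have "(v \<bullet> v) *\<^sub>R u = (v \<bullet> u) *\<^sub>R v"
    using Lagrange[of v u v] assms(1) by simp
  then have "(1 / (v \<bullet> v)) *\<^sub>R (v \<bullet> v) *\<^sub>R u = (1 / (v \<bullet> v)) *\<^sub>R (v \<bullet> u) *\<^sub>R v" by simp
  then show ?thesis using assms(2) that by simp
qed

text \<open>
  For an orthogonal matrix \<open>A\<close> of determinant \<open>1\<close>, multiplying \<open>A - 1\<close> by the transpose of \<open>A\<close> gives the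
  transpose of \<open>1 - A\<close>. In odd dimension this forces \<open>det (A - 1) = - det (A - 1)\<close>.
\<close>

lemma rotation_has_axis:
  fixes T :: "real^3 \<Rightarrow> real^3"
  assumes orth: "orthogonal_transformation T" and cross: "\<And>x y. T (x \<times> y) = T x \<times> T y"
  obtains u where "u \<noteq> 0" "T u = u"
proof -
  define A where "A = matrix T"
  have lin: "linear T" using orth by (rule orthogonal_transformation_linear)
  have T: "T x = A *v x" for x
    unfolding A_def using lin by simp
  have OA: "orthogonal_matrix A"
    using orth by (simp add: A_def orthogonal_transformation_matrix)
  have "det A = 1"
  proof -
    have "\<exists>x y :: real^3. x \<times> y \<noteq> 0"
      using cross_basis by (metis axis_eq_0_iff zero_neq_one)
    then obtain x y :: "real^3" where "x \<times> y \<noteq> 0" by blast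
    then have "T (x \<times> y) \<noteq> 0"
      using orthogonal_transformation_norm[OF orth, of "x \<times> y"] by auto
    moreover have "T (x \<times> y) = det A *\<^sub>R T (x \<times> y)"
      using cross_orthogonal_transformation[OF orth, of x y] cross[of x y] by (simp add: A_def)
    ultimately show ?thesis by (metis scaleR_cancel_right scaleR_one)
  qed
  have "transpose A ** (A - mat 1) = transpose (mat 1 - A)"
  proof -
    have "transpose A ** (A - mat 1) + transpose A = transpose A ** A"
      by (simp flip: matrix_add_ldistrib[of _ "A - mat 1" "mat 1", simplified])
    then have "transpose A ** (A - mat 1) = mat 1 - transpose A"
      using OA by (simp add: orthogonal_matrix algebra_simps)
    then show ?thesis
      by (simp add: transpose_def mat_def vec_eq_iff)
  qed
  then have "det A * det (A - mat 1) = det (mat 1 - A)"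
    by (metis det_mul det_transpose)
  also have "det (mat 1 - A) = - det (A - mat 1)"
    by (simp add: det_3 algebra_simps)
  finally have "det (A - mat 1) = 0"
    using \<open>det A = 1\<close> by simp
  then have "\<not> invertible (A - mat 1)"
    by (simp add: invertible_det_nz)
  then obtain u where "u \<noteq> 0" "(A - mat 1) *v u = 0"
    using matrix_left_invertible_ker[of "A - mat 1"] invertible_left_inverse by blast
  then show ?thesis
    using that by (simp add: T matrix_vector_mult_diff_rdistrib)
qed

lemma rotation_fixing_two_directions:
  fixes T :: "real^3 \<Rightarrow> real^3"
  assumes "linear T" and cross: "\<And>x y. T (x \<times> y) = T x \<times> T y"
    and "T u = u" "T v = v" "u \<times> v \<noteq> 0"
  shows "T w = w"
proof -
  interpret linear T by fact
  have "((u \<times> v) \<bullet> (u \<times> v)) *\<^sub>R T w = T (((u \<times> v) \<bullet> (u \<times> v)) *\<^sub>R w)"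
    by (simp add: scaleR)
  also have "\<dots> = ((u \<times> v) \<bullet> (u \<times> v)) *\<^sub>R w"
    unfolding cross_decomposition by (simp add: add diff scaleR cross assms(3,4))
  finally show ?thesis using assms(5) by simp
qed

text \<open>
  On the plane orthogonal to the common axis \<open>u\<close>, both maps have the form \<open>s + t J\<close> with the quarter
  turn \<open>J = (\<times>) u\<close> (up to scale), and such maps commute. It is enough to compute on one vector \<open>w\<close> of
  this plane, because \<open>w\<close> and \<open>u \<times> w\<close> span it and both maps commute with \<open>J\<close>.
\<close>

lemma coaxial_rotations_commute:
  fixes S T :: "real^3 \<Rightarrow> real^3"
  assumes S: "orthogonal_transformation S" "\<And>x y. S (x \<times> y) = S x \<times> S y" "S u = u"
    and T: "orthogonal_transformation T" "\<And>x y. T (x \<times> y) = T x \<times> T y" "T u = u"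
    and "u \<noteq> 0"
  shows "S (T x) = T (S x)"
proof -
  interpret S: linear S using S(1) by (rule orthogonal_transformation_linear)
  interpret T: linear T using T(1) by (rule orthogonal_transformation_linear)
  define c where "c = (x \<bullet> u) / (u \<bullet> u)"
  define w where "w = x - c *\<^sub>R u"
  have wu: "w \<bullet> u = 0" using \<open>u \<noteq> 0\<close> by (simp add: w_def c_def inner_diff_left)
  have x: "x = c *\<^sub>R u + w" by (simp add: w_def)
  have "S (T w) = T (S w)"
  proof (cases "w = 0")
    case False
    have "w \<times> (u \<times> w) \<noteq> 0"
      using wu False \<open>u \<noteq> 0\<close> by (simp add: Lagrange wu)
    have plane: "\<exists>s t. z = s *\<^sub>R w + t *\<^sub>R (u \<times> w)" if "z \<bullet> u = 0" for z
    proof -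
      have "z \<bullet> (w \<times> (u \<times> w)) = 0" using that by (simp add: Lagrange wu)
      then show ?thesis using in_plane_of_cross[OF \<open>w \<times> (u \<times> w) \<noteq> 0\<close>] by metis
    qed
    have "S w \<bullet> u = 0" "T w \<bullet> u = 0"
      using S(1,3) T(1,3) wu unfolding orthogonal_transformation_def by metis+
    then obtain s t s' t' where st: "S w = s *\<^sub>R w + t *\<^sub>R (u \<times> w)" "T w = s' *\<^sub>R w + t' *\<^sub>R (u \<times> w)"
      using plane by metis
    have "S (T w) = s' *\<^sub>R S w + t' *\<^sub>R (u \<times> S w)"
      unfolding st(2) by (simp add: S.add S.scaleR S(2,3))
    moreover have "T (S w) = s *\<^sub>R T w + t *\<^sub>R (u \<times> T w)"
      unfolding st(1) by (simp add: T.add T.scaleR T(2,3))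
    ultimately show ?thesis
      unfolding st by (simp add: cross_add_right cross_mult_right algebra_simps)
  qed (simp add: S.zero T.zero)
  then have "S (T (c *\<^sub>R u + w)) = T (S (c *\<^sub>R u + w))"
    by (simp add: S.add T.add S.scaleR T.scaleR S(3) T(3))
  then show ?thesis
    by (simp only: x[symmetric])
qed

section \<open>Groups of rotations in which every element has a fixed point\<close>

locale rotation_GAF =
  fixes H :: "(real^3 \<Rightarrow> real^3) set"
  assumes closed: "f \<in> H \<Longrightarrow> g \<in> H \<Longrightarrow> f \<circ> g \<in> H"
    and inverse: "f \<in> H \<Longrightarrow> \<exists>g\<in>H. g \<circ> f = id \<and> f \<circ> g = id"
    and rigid: "f \<in> H \<Longrightarrow> rigid_motion f"
    and fixed_point: "f \<in> H \<Longrightarrow> \<exists>x. f x = x"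
begin

lemma orth: "f \<in> H \<Longrightarrow> orthogonal_transformation (linear_part f)"
  and cross: "f \<in> H \<Longrightarrow> linear_part f (x \<times> y) = linear_part f x \<times> linear_part f y"
  using rigid by (auto simp: rigid_motion_def)

lemma lin: "f \<in> H \<Longrightarrow> linear (linear_part f)"
  using orth by (rule orthogonal_transformation_linear)

lemma dist_eq: "f \<in> H \<Longrightarrow> dist (f x) (f y) = dist x y"
  using orthogonal_transformation_norm[OF orth, of f "x - y"]
  by (simp add: linear_part_diff[OF orth] dist_norm)

lemma fixed_iff: "f \<in> H \<Longrightarrow> f p = p \<Longrightarrow> f x = x \<longleftrightarrow> linear_part f (x - p) = x - p"
  using fixed_iff_linear_part orth by blast

lemma trivial_linear_part:
  assumes "f \<in> H" "\<And>x. linear_part f x = x"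
  shows "f = id"
proof -
  obtain p where "f p = p" using fixed_point assms(1) by blast
  then show ?thesis using fixed_iff assms by (auto simp: fun_eq_iff)
qed

text \<open>
  Together with \<open>rotation_has_axis\<close> this shows that the fixed points of a nontrivial element form
  exactly one line.
\<close>

lemma fixed_directions_parallel:
  assumes "f \<in> H" "f \<noteq> id" "linear_part f u = u" "linear_part f v = v"
  shows "u \<times> v = 0"
  using rotation_fixing_two_directions[OF lin cross] trivial_linear_part assms by blast

text \<open>
  The fixed points of a nontrivial element form a line. Let \<open>x\<close> be fixed by \<open>f \<circ> g\<close>, and let \<open>y = g x\<close>.
  If \<open>y = x\<close>, then \<open>x\<close> is a common fixed point. Otherwise both axes consist of points equidistant from
  \<open>x\<close> and \<open>y\<close>, hence lie in one plane, so that they meet unless they are parallel. For parallel axes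
  the linear parts commute, so the commutator of \<open>f\<close> and \<open>g\<close> is a translation. Having a fixed point it
  is trivial, so \<open>g\<close> commutes with \<open>f\<close> and preserves the axis of \<open>f\<close>. As a rotation about a parallel
  axis, \<open>g\<close> moves points only at right angles to that direction, so it fixes the axis of \<open>f\<close> pointwise.
\<close>

lemma axes_meet:
  assumes f: "f \<in> H" "f \<noteq> id" and g: "g \<in> H" "g \<noteq> id"
  shows "\<exists>p. f p = p \<and> g p = p"
proof -
  obtain a u where a: "f a = a" and u: "u \<noteq> 0" "linear_part f u = u"
    using fixed_point[OF f(1)] rotation_has_axis[OF orth cross] f(1) by metis
  obtain b v where b: "g b = b" and v: "v \<noteq> 0" "linear_part g v = v"
    using fixed_point[OF g(1)] rotation_has_axis[OF orth cross] g(1) by metis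
  interpret lf: linear "linear_part f" using lin[OF f(1)] .
  interpret lg: linear "linear_part g" using lin[OF g(1)] .
  have on_f: "f (a + s *\<^sub>R u) = a + s *\<^sub>R u" for s
    using fixed_iff[OF f(1) a] u(2) by (simp add: lf.scaleR)
  have on_g: "g (b + s *\<^sub>R v) = b + s *\<^sub>R v" for s
    using fixed_iff[OF g(1) b] v(2) by (simp add: lg.scaleR)
  show ?thesis
  proof (cases "u \<times> v = 0")
    case True
    then obtain c where c: "u = c *\<^sub>R v" using v(1) parallel_of_cross_eq_0 by blast
    then have gu: "linear_part g u = u" using v(2) by (simp add: lg.scaleR)
    obtain f' where f': "f' \<in> H" "f' \<circ> f = id" "f \<circ> f' = id" using inverse f(1) by blast
    obtain g' where g': "g' \<in> H" "g' \<circ> g = id" "g \<circ> g' = id" using inverse g(1) by blast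
    define h where "h = f \<circ> g \<circ> f' \<circ> g'"
    have "h \<in> H" by (simp add: h_def closed f g f' g')
    have commute: "linear_part f (linear_part g x) = linear_part g (linear_part f x)" for x
      using coaxial_rotations_commute[OF orth[OF f(1)] cross[OF f(1)] u(2) orth[OF g(1)] cross[OF g(1)] gu u(1)] .
    have id: "linear_part id x = x" for x :: "real^3" by (simp add: linear_part_def)
    have "linear_part h x = x" for x
    proof -
      have "linear_part h x = linear_part f (linear_part g (linear_part f' (linear_part g' x)))"
        by (simp add: h_def linear_part_comp[OF orth] closed f g f' g')
      also have "\<dots> = linear_part g (linear_part f (linear_part f' (linear_part g' x)))"
        by (rule commute)
      also have "\<dots> = x"
        using linear_part_comp[OF orth[OF f(1)], of f'] linear_part_comp[OF orth[OF g(1)], of g'] f'(3) g'(3) id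
        by simp
      finally show ?thesis .
    qed
    then have "h = id" using trivial_linear_part \<open>h \<in> H\<close> by blast
    then have "h (g (f a)) = g (f a)" by simp
    moreover have "h (g (f a)) = f (g a)"
      using f'(2) g'(2) by (simp add: h_def fun_eq_iff)
    ultimately have "f (g a) = g a" using a by simp
    then have "linear_part f (g a - a) = g a - a" using fixed_iff[OF f(1) a] by blast
    then have "(g a - a) \<times> u = 0" using fixed_directions_parallel f u(2) by blast
    moreover have "(g a - a) \<bullet> u = 0"
    proof -
      have "linear_part g (a - b) \<bullet> linear_part g u = (a - b) \<bullet> u"
        using orth[OF g(1)] by (simp add: orthogonal_transformation_def)
      then show ?thesis
        by (simp add: gu linear_part_diff[OF orth[OF g(1)]] b inner_diff_left)
    qed
    ultimately have "g a - a = 0" using u(1) norm_and_cross_eq_0 by blast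
    then have "g a = a" by simp
    with a show ?thesis by blast
  next
    case False
    obtain x where x: "(f \<circ> g) x = x" using fixed_point closed f g by blast
    define y where "y = g x"
    have "f y = x" using x by (simp add: y_def)
    define m where "m = x - y"
    show ?thesis
    proof (cases "m = 0")
      case True
      then show ?thesis using \<open>f y = x\<close> by (auto simp: m_def y_def)
    next
      case m: False
      \<comment> \<open>All fixed points of \<open>f\<close> and of \<open>g\<close> lie in the perpendicular bisector plane of \<open>x\<close> and \<open>y\<close>.\<close>
      have bisector: "m \<bullet> p = m \<bullet> q" if "f p = p \<or> g p = p" "f q = q \<or> g q = q" for p q
      proof -
        have "2 * (m \<bullet> p) = x \<bullet> x - y \<bullet> y" if "f p = p \<or> g p = p" for p
        proof -
          have "dist x p = dist y p"
            using that dist_eq[OF f(1), of y p] dist_eq[OF g(1), of x p] \<open>f y = x\<close> y_def by auto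
          then have "(x - p) \<bullet> (x - p) = (y - p) \<bullet> (y - p)"
            by (simp add: dist_norm norm_eq)
          then show ?thesis
            by (simp add: m_def inner_diff_left inner_diff_right inner_commute)
        qed
        from this[OF that(1)] this[OF that(2)] show ?thesis by simp
      qed
      have mu: "m \<bullet> u = 0" using bisector[of "a + 1 *\<^sub>R u" a] on_f[of 1] a by (simp add: inner_add_right)
      have mv: "m \<bullet> v = 0" using bisector[of "b + 1 *\<^sub>R v" b] on_g[of 1] b by (simp add: inner_add_right)
      have "m \<bullet> (b - a) = 0" using bisector[of b a] a b by (simp add: inner_diff_right)
      define n where "n = u \<times> v"
      have nm: "(n \<bullet> n) *\<^sub>R m = (m \<bullet> n) *\<^sub>R n"
        using cross_decomposition[of u v m] mu mv by (simp add: n_def)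
      then have "(m \<bullet> n) * (n \<bullet> (b - a)) = (n \<bullet> n) * (m \<bullet> (b - a))"
        by (metis inner_scaleR_left)
      moreover have "m \<bullet> n \<noteq> 0" using nm m False by (auto simp: n_def)
      ultimately have "(b - a) \<bullet> (u \<times> v) = 0"
        using \<open>m \<bullet> (b - a) = 0\<close> by (simp add: n_def inner_commute)
      then obtain s t where "b - a = s *\<^sub>R u + t *\<^sub>R v"
        using in_plane_of_cross False by blast
      then have "a + s *\<^sub>R u = b + (-t) *\<^sub>R v" by (simp add: algebra_simps)
      then show ?thesis using on_f[of s] on_g[of "-t"] by metis
    qed
  qed
qed

text \<open>
  Let the axes of \<open>f\<close> and \<open>g\<close> cross in \<open>p\<close> and suppose that the axis of \<open>k\<close> misses \<open>p\<close>. It meets both axes,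
  so the three lines form a triangle in a plane with normal \<open>n\<close>. An axis through \<open>p\<close> must meet the axis
  of \<open>k\<close> as well and hence lies in this plane. Applied to conjugates of \<open>f\<close> and \<open>g\<close>, this says that both
  maps preserve the plane, so they are half-turns, which reverse \<open>n\<close>. Then \<open>f \<circ> g\<close> is a nontrivial
  element whose axis has the direction \<open>n\<close>, out of the plane.
\<close>

lemma fixes_isolated_intersection:
  assumes f: "f \<in> H" "f \<noteq> id" "f p = p" and g: "g \<in> H" "g \<noteq> id" "g p = p"
    and unique: "\<And>x. f x = x \<Longrightarrow> g x = x \<Longrightarrow> x = p"
    and k: "k \<in> H"
  shows "k p = p"
proof (rule ccontr)
  assume kp: "k p \<noteq> p"
  then have "k \<noteq> id" by auto
  interpret lf: linear "linear_part f" using lin[OF f(1)] .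
  interpret lg: linear "linear_part g" using lin[OF g(1)] .
  obtain q r where q: "f q = q" "k q = q" and r: "g r = r" "k r = r"
    using axes_meet[OF f(1,2) k \<open>k \<noteq> id\<close>] axes_meet[OF g(1,2) k \<open>k \<noteq> id\<close>] by blast
  define u where "u = q - p"
  define v where "v = r - p"
  have "u \<noteq> 0" "v \<noteq> 0" using q r kp by (auto simp: u_def v_def)
  have fu: "linear_part f u = u" and gv: "linear_part g v = v"
    using fixed_iff[OF f(1,3)] fixed_iff[OF g(1,3)] q r by (auto simp: u_def v_def)
  define n where "n = u \<times> v"
  have "n \<noteq> 0"
  proof
    assume "n = 0"
    then obtain c where "u = c *\<^sub>R v"
      using parallel_of_cross_eq_0[of u v] \<open>v \<noteq> 0\<close> n_def by metis
    then have "linear_part g u = u" using gv by (simp add: lg.scaleR)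
    then have "g q = q" using fixed_iff[OF g(1,3)] by (simp add: u_def)
    then show False using unique q(1) \<open>u \<noteq> 0\<close> by (simp add: u_def)
  qed
  have "v - u \<noteq> 0" using \<open>n \<noteq> 0\<close> by (auto simp: n_def)
  \<comment> \<open>The axis of \<open>k\<close> is the line through \<open>q\<close> and \<open>r\<close>, so it lies in the plane of the triangle.\<close>
  have axis_k: "(z - p) \<bullet> n = 0" if "k z = z" for z
  proof -
    have "linear_part k (z - q) = z - q" "linear_part k (v - u) = v - u"
      using fixed_iff[OF k q(2)] that r by (auto simp: u_def v_def)
    then have "(z - q) \<times> (v - u) = 0" using fixed_directions_parallel k \<open>k \<noteq> id\<close> by blast
    then obtain c where "z - q = c *\<^sub>R (v - u)"
      using \<open>v - u \<noteq> 0\<close> parallel_of_cross_eq_0 by blast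
    then have "z - p = u + c *\<^sub>R (v - u)" by (simp add: u_def algebra_simps)
    then show ?thesis by (simp add: n_def inner_add_left inner_diff_left dot_cross_self)
  qed
  \<comment> \<open>An axis through \<open>p\<close> is spanned by \<open>p\<close> and the point \<open>z\<close> where it meets the axis of \<open>k\<close>.\<close>
  have in_plane: "(x - p) \<bullet> n = 0" if e: "e \<in> H" "e \<noteq> id" "e p = p" and "e x = x" for e x
  proof -
    obtain z where z: "e z = z" "k z = z" using axes_meet e k \<open>k \<noteq> id\<close> by blast
    then have "z - p \<noteq> 0" using kp by auto
    have "(x - p) \<times> (z - p) = 0"
      using fixed_directions_parallel fixed_iff e \<open>e x = x\<close> z by blast
    then obtain c where "x - p = c *\<^sub>R (z - p)"
      using \<open>z - p \<noteq> 0\<close> parallel_of_cross_eq_0 by blast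
    then show ?thesis using axis_k[OF z(2)] by simp
  qed
  \<comment> \<open>The axis of the conjugate of \<open>h\<close> by \<open>e\<close> is the image of the axis of \<open>h\<close> under \<open>e\<close>.\<close>
  have conj: "linear_part e (x - p) \<bullet> n = 0"
    if e: "e \<in> H" "e p = p" and h: "h \<in> H" "h \<noteq> id" "h p = p" and x: "h x = x" for e h x
  proof -
    obtain e' where e': "e' \<in> H" "e' \<circ> e = id" "e \<circ> e' = id" using inverse e(1) by blast
    have cancel: "e' (e y) = y" "e (e' y) = y" for y using e' by (simp_all add: fun_eq_iff)
    have "e \<circ> h \<circ> e' \<noteq> id"
    proof
      assume "e \<circ> h \<circ> e' = id"
      then have "e (h y) = e y" for y by (metis cancel(1) comp_apply id_apply)
      then have "h y = y" for y by (metis cancel(1))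
      then show False using h(2) by auto
    qed
    moreover have "(e \<circ> h \<circ> e') p = p" using e(2) h(3) cancel(1)[of p] by simp
    moreover have "(e \<circ> h \<circ> e') (e x) = e x" using x cancel by simp
    ultimately have "(e x - p) \<bullet> n = 0"
      using in_plane closed e h e' by blast
    then show ?thesis by (simp add: linear_part_diff[OF orth[OF e(1)]] e(2))
  qed
  have half_turn: "linear_part e n = - n"
    if e: "e \<in> H" "e \<noteq> id" "e p = p" and w: "linear_part e w = w" "w \<noteq> 0" "w \<bullet> n = 0"
      and t: "linear_part e n = t *\<^sub>R n" for e w t
  proof -
    have "norm (linear_part e n) = norm n"
      by (rule orthogonal_transformation_norm[OF orth[OF e(1)]])
    then have "\<bar>t\<bar> = 1" using t \<open>n \<noteq> 0\<close> by simp
    moreover have "t \<noteq> 1"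
    proof
      assume "t = 1"
      then have "w \<times> n = 0" using fixed_directions_parallel e w t by auto
      then show False using w \<open>n \<noteq> 0\<close> norm_and_cross_eq_0 by blast
    qed
    ultimately show ?thesis using t by (auto simp: abs_if split: if_splits)
  qed
  have fn: "linear_part f n = - n"
  proof -
    have "linear_part f v \<bullet> (u \<times> v) = 0"
      using conj[OF f(1,3) g r(1)] by (simp add: v_def n_def)
    then obtain s t where "linear_part f v = s *\<^sub>R u + t *\<^sub>R v"
      using in_plane_of_cross \<open>n \<noteq> 0\<close> n_def by blast
    then have "linear_part f n = t *\<^sub>R n"
      by (simp add: n_def cross[OF f(1)] fu cross_add_right cross_mult_right)
    then show ?thesis
      using half_turn[OF f fu \<open>u \<noteq> 0\<close> _ \<open>linear_part f n = t *\<^sub>R n\<close>]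
      by (simp add: n_def dot_cross_self)
  qed
  have gn: "linear_part g n = - n"
  proof -
    have "linear_part g u \<bullet> (u \<times> v) = 0"
      using conj[OF g(1,3) f q(1)] by (simp add: u_def n_def)
    then obtain s t where "linear_part g u = s *\<^sub>R u + t *\<^sub>R v"
      using in_plane_of_cross \<open>n \<noteq> 0\<close> n_def by blast
    then have "linear_part g n = s *\<^sub>R n"
      by (simp add: n_def cross[OF g(1)] gv cross_add_left cross_mult_left)
    then show ?thesis
      using half_turn[OF g gv \<open>v \<noteq> 0\<close> _ \<open>linear_part g n = s *\<^sub>R n\<close>]
      by (simp add: n_def dot_cross_self)
  qed
  have "f \<circ> g \<noteq> id"
  proof
    assume "f \<circ> g = id"
    then have "f r = r" using r(1) by (metis comp_apply id_apply)
    then show False using unique r(1) \<open>v \<noteq> 0\<close> by (simp add: v_def)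
  qed
  moreover have fgp: "(f \<circ> g) p = p" using f g by simp
  moreover have "linear_part (f \<circ> g) n = n"
    by (simp add: linear_part_comp[OF orth[OF f(1)]] gn lf.neg fn)
  then have "(f \<circ> g) (p + n) = p + n"
    using fixed_iff[OF closed[OF f(1) g(1)] fgp, of "p + n"] by (metis add_diff_cancel_left')
  ultimately have "(p + n - p) \<bullet> n = 0"
    using in_plane[OF closed[OF f(1) g(1)]] by blast
  then show False using \<open>n \<noteq> 0\<close> by simp
qed

text \<open>
  Take a nontrivial \<open>f\<close>. Either all elements fix its axis pointwise, or some axis crosses it in a single
  point, which is then fixed by everything.
\<close>

lemma common_fixed_point: "\<exists>p. \<forall>f\<in>H. f p = p"
proof (cases "H \<subseteq> {id}")
  case True
  then have "f p = p" if "f \<in> H" for f p using that by auto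
  then show ?thesis by blast
next
  case False
  then obtain f where f: "f \<in> H" "f \<noteq> id" by blast
  show ?thesis
  proof (cases "\<forall>g\<in>H. \<forall>x. f x = x \<longrightarrow> g x = x")
    case True
    then show ?thesis using fixed_point f(1) by blast
  next
    case False
    then obtain g y where g: "g \<in> H" and y: "f y = y" "g y \<noteq> y" by blast
    then have "g \<noteq> id" by auto
    obtain p where p: "f p = p" "g p = p" using axes_meet f g \<open>g \<noteq> id\<close> by blast
    interpret lg: linear "linear_part g" using lin[OF g] .
    have "x = p" if x: "f x = x" "g x = x" for x
    proof (rule ccontr)
      assume "x \<noteq> p"
      moreover have "(y - p) \<times> (x - p) = 0"
        using fixed_directions_parallel fixed_iff f p y(1) x(1) by blast
      ultimately obtain c where "y - p = c *\<^sub>R (x - p)"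
        using parallel_of_cross_eq_0 by (metis right_minus_eq)
      then have "linear_part g (y - p) = y - p"
        using fixed_iff[OF g p(2), of x] x(2) by (simp add: lg.scaleR)
      then show False using fixed_iff[OF g p(2)] y(2) by blast
    qed
    then show ?thesis
      using fixes_isolated_intersection[OF f p(1) g \<open>g \<noteq> id\<close> p(2)] by blast
  qed
qed

end

section \<open>The critical dimension\<close>

lemma rotation_or_rotoinversion:
  fixes T :: "real^3 \<Rightarrow> real^3"
  assumes "orthogonal_transformation T"
  shows "(\<forall>x y. T (x \<times> y) = T x \<times> T y) \<or> (\<forall>x y. T (x \<times> y) = - (T x \<times> T y))"
proof -
  have "det (matrix T) = 1 \<or> det (matrix T) = - 1"
    using assms det_orthogonal_matrix orthogonal_transformation_matrix by blast
  then show ?thesis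
    using cross_orthogonal_transformation[OF assms] by auto
qed

lemma isometry_midpoint:
  assumes "orthogonal_transformation (linear_part f)"
  shows "f (midpoint x y) = midpoint (f x) (f y)"
proof -
  interpret linear "linear_part f" using assms by (rule orthogonal_transformation_linear)
  have f: "f z = linear_part f z + f 0" for z by (simp add: linear_part_def)
  have "f (midpoint x y) = (1/2) *\<^sub>R (linear_part f x + linear_part f y) + f 0"
    unfolding f[of "midpoint x y"] by (simp add: midpoint_def scaleR add)
  also have "\<dots> = (1/2) *\<^sub>R ((linear_part f x + f 0) + (linear_part f y + f 0))"
    by (simp add: algebra_simps flip: scaleR_2)
  finally show ?thesis
    by (simp add: midpoint_def linear_part_def)
qed

text \<open>
  The orientation-preserving elements form a subgroup \<open>K\<close> of index at most \<open>2\<close> with a common fixed point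
  \<open>p\<close>. If there is an element \<open>r\<close> outside \<open>K\<close>, then the whole group permutes \<open>p\<close> and \<open>r p\<close>, and thus
  fixes their midpoint.
\<close>

lemma fixating_isom_group_3: "fixating UNIV (isom_group :: (real^3 \<Rightarrow> real^3) set)"
  unfolding fixating_def
proof (intro allI impI, elim conjE)
  fix H :: "(real^3 \<Rightarrow> real^3) set"
  assume H: "subgroup H (BijGroup UNIV)" "H \<subseteq> isom_group" "GAF UNIV H"
  note H' = H(1)[unfolded subgroup_BijGroup_UNIV_iff]
  have orth_H: "orthogonal_transformation (linear_part f)" if "f \<in> H" for f
    using that H(2) by (intro orthogonal_linear_part) (auto simp: isom_group_def)
  have linear_part_comp_H: "linear_part (f \<circ> g) x = linear_part f (linear_part g x)" if "f \<in> H" for f g x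
    using linear_part_comp orth_H that by blast
  define K where "K = {f \<in> H. rigid_motion f}"
  have inv: "inv_into UNIV f \<in> H" "inv_into UNIV f \<circ> f = id" "f \<circ> inv_into UNIV f = id" if "f \<in> H" for f
    using that H' by (auto simp: bij_is_surj bij_is_inj simp flip: surj_iff)
  have K_comp: "f \<circ> g \<in> K" if "f \<in> K" "g \<in> K" for f g
    using that H' orth_H linear_part_comp_H by (auto simp: K_def rigid_motion_def)
  have reversed_comp: "f \<circ> g \<in> K" if fg: "f \<in> H - K" "g \<in> H - K" for f g
  proof -
    have rev: "linear_part h (x \<times> y) = - (linear_part h x \<times> linear_part h y)" if "h \<in> H - K" for h x y
      using that rotation_or_rotoinversion[OF orth_H[of h]] orth_H[of h] by (auto simp: K_def rigid_motion_def)
    have "f \<in> H" "f \<circ> g \<in> H" using fg H' by auto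
    then have "linear_part (f \<circ> g) (x \<times> y) = linear_part (f \<circ> g) x \<times> linear_part (f \<circ> g) y" for x y
      using orthogonal_transformation_linear[OF orth_H, of f]
      by (simp add: linear_part_comp_H rev[OF fg(1)] rev[OF fg(2)] linear_neg)
    then show ?thesis
      using \<open>f \<circ> g \<in> H\<close> orth_H by (simp add: K_def rigid_motion_def)
  qed
  have K_inv: "inv_into UNIV f \<in> K" if f: "f \<in> K" for f
  proof -
    have "f \<in> H" using f by (simp add: K_def)
    define f' where "f' = inv_into UNIV f"
    have cancel: "linear_part f (linear_part f' x) = x" for x
      using linear_part_comp_H[OF \<open>f \<in> H\<close>, of f' x] inv(3)[OF \<open>f \<in> H\<close>] by (simp add: f'_def linear_part_def)
    have "linear_part f (linear_part f' (x \<times> y)) = linear_part f (linear_part f' x \<times> linear_part f' y)" for x y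
      using f by (simp add: cancel K_def rigid_motion_def)
    then have "linear_part f' (x \<times> y) = linear_part f' x \<times> linear_part f' y" for x y
      using orthogonal_transformation_inj[OF orth_H[OF \<open>f \<in> H\<close>]] by (simp add: inj_eq)
    then show ?thesis
      using inv(1)[OF \<open>f \<in> H\<close>] orth_H by (simp add: K_def rigid_motion_def f'_def)
  qed
  have inv_reversed: "inv_into UNIV f \<in> H - K" if "f \<in> H - K" for f
  proof -
    have "bij f" "f \<in> H" "f \<notin> K" using that H' by auto
    then show ?thesis using K_inv[of "inv_into UNIV f"] inv(1) by (auto simp: inv_inv_eq)
  qed
  interpret rotation_GAF K
  proof
    show "\<exists>g\<in>K. g \<circ> f = id \<and> f \<circ> g = id" if "f \<in> K" for f
      using that K_inv inv by (intro bexI[of _ "inv_into UNIV f"]) (auto simp: K_def)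
    show "\<exists>x. f x = x" if "f \<in> K" for f
      using that H(3) by (auto simp: K_def GAF_def Fix_def)
  qed (use K_comp in \<open>auto simp: K_def\<close>)
  obtain p where p: "\<And>f. f \<in> K \<Longrightarrow> f p = p" using common_fixed_point by blast
  have "\<exists>q. \<forall>f\<in>H. f q = q"
  proof (cases "H \<subseteq> K")
    case True
    then show ?thesis using p by blast
  next
    case False
    then obtain r where r: "r \<in> H - K" by blast
    have "f (midpoint p (r p)) = midpoint p (r p)" if f: "f \<in> H" for f
    proof (cases "f \<in> K")
      case True
      have "f \<circ> r \<in> H - K"
      proof
        show "f \<circ> r \<in> H" using f r H' by blast
        show "f \<circ> r \<notin> K"
        proof
          assume "f \<circ> r \<in> K"
          then have "inv_into UNIV f \<circ> (f \<circ> r) \<in> K" using K_comp K_inv True by blast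
          then show False using r inv(2)[OF f] by (simp flip: comp_assoc)
        qed
      qed
      moreover have "inv_into UNIV r \<in> H - K"
        by (rule inv_reversed[OF r])
      ultimately have "inv_into UNIV r \<circ> (f \<circ> r) \<in> K" using reversed_comp by blast
      then have "inv_into UNIV r (f (r p)) = p" using p by force
      then have "f (r p) = r p" using inv(3)[of r] r by (metis DiffD1 comp_apply id_apply)
      then show ?thesis using isometry_midpoint[OF orth_H[OF f]] p[OF True] by simp
    next
      case False
      then have "f (r p) = p" using p[OF reversed_comp[of f r]] f r by simp
      have "inv_into UNIV r \<in> H - K"
        by (rule inv_reversed[OF r])
      then have "inv_into UNIV r (f p) = p" using p[OF reversed_comp[of "inv_into UNIV r" f]] f False by simp
      then have "f p = r p" using inv(3)[of r] r by (metis DiffD1 comp_apply id_apply)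
      then show ?thesis
        using isometry_midpoint[OF orth_H[OF f]] \<open>f (r p) = p\<close> by (simp add: midpoint_sym)
    qed
    then show ?thesis by blast
  qed
  then show "GAG UNIV H" by (auto simp: GAG_def Fix_def)
qed

theorem theorem5p1:
  "fixating UNIV (isom_group :: (real ^ 'n::finite \<Rightarrow> real ^ 'n) set) \<longleftrightarrow> CARD('n) \<le> 3"
proof
  assume fixating: "fixating UNIV (isom_group :: (real ^ 'n \<Rightarrow> real ^ 'n) set)"
  show "CARD('n) \<le> 3"
  proof (rule ccontr)
    assume "\<not> CARD('n) \<le> 3"
    then have "DIM(complex \<times> complex) \<le> DIM(real ^ 'n)" by simp
    then show False
      using fixating fixating_isom_group_mono not_fixating_isom_group_4 by blast
  qed
next
  assume "CARD('n) \<le> 3"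
  then have "DIM(real ^ 'n) \<le> DIM(real ^ 3)" by simp
  then show "fixating UNIV (isom_group :: (real ^ 'n \<Rightarrow> real ^ 'n) set)"
    using fixating_isom_group_mono fixating_isom_group_3 by blast
qed

end
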